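(* Let $\mu>0$, let $m\ge2$ be an integer and $\beta=\frac1m$. The density function $f_\mu(x,t)$ of the tempered stable subordinator $D_\mu(t)$ of index $\beta$ satisfies, for $x,t>0$, $$\sum_{j=1}^m(-1)^j\binom{m}{j}\mu^{(1-j/m)}\frac{\partial^j}{\partial t^j}f_\mu(x,t)=\frac{\partial}{\partial x}f_\mu(x,t).$$
   Context: Let $f(x,t)$ be the density of the stable subordinator of index $\beta\in(0,1)$, i.e. $\int_0^\infty e^{-sx}f(x,t)\,dx=e^{-ts^\beta}$. The tempered stable subordinator $D_\mu(t)$ has density $f_\mu(x,t)=e^{-\mu x+\mu^\beta t}f(x,t)$, $x>0$; equivalently $\int_0^\infty e^{-sx}f_\mu(x,t)\,dx=e^{-t((s+\mu)^\beta-\mu^\beta)}$. *)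

theory Defs
  imports "HOL-Probability.Probability"
begin

text \<open>A Laplace transform determines a density only up to null sets. Continuity on the open
  half-line selects the classical version, so \<open>f x t\<close> is determined for all \<open>x > 0\<close>,
  \<open>t > 0\<close>; values elsewhere are unconstrained. The case \<open>s = 0\<close> says that
  the total mass is 1 (in HOL, \<open>0 powr \<beta> = 0\<close>).\<close>

definition stable_subordinator_density :: "real \<Rightarrow> (real \<Rightarrow> real \<Rightarrow> real) \<Rightarrow> bool" where
  "stable_subordinator_density \<beta> f \<longleftrightarrow>
     (\<forall>t>0. (\<forall>x>0. f x t \<ge> 0) \<and>
            continuous_on {0<..} (\<lambda>x. f x t) \<and>
            (\<forall>s\<ge>0. has_bochner_integral lborel
               (\<lambda>x. indicator {0<..} x *\<^sub>R (exp (- s * x) * f x t))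
               (exp (- t * s powr \<beta>))))"

definition tempered_density ::
  "real \<Rightarrow> real \<Rightarrow> (real \<Rightarrow> real \<Rightarrow> real) \<Rightarrow> real \<Rightarrow> real \<Rightarrow> real" where
  "tempered_density \<mu> \<beta> f x t = exp (- \<mu> * x + \<mu> powr \<beta> * t) * f x t"

lemma tempered_density_laplace:
  assumes "stable_subordinator_density \<beta> f" "\<mu> > 0" "t > 0" "s \<ge> 0"
  shows "has_bochner_integral lborel
           (\<lambda>x. indicator {0<..} x *\<^sub>R (exp (- s * x) * tempered_density \<mu> \<beta> f x t))
           (exp (- t * ((s + \<mu>) powr \<beta> - \<mu> powr \<beta>)))"
proof -
  have "s + \<mu> \<ge> 0"
    using assms by simp
  with assms have "has_bochner_integral lborel
      (\<lambda>x. indicator {0<..} x *\<^sub>R (exp (- (s + \<mu>) * x) * f x t)) (exp (- t * (s + \<mu>) powr \<beta>))"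
    unfolding stable_subordinator_density_def by blast
  from has_bochner_integral_mult_right[OF this, of "exp (\<mu> powr \<beta> * t)"]
  have "has_bochner_integral lborel
      (\<lambda>x. exp (\<mu> powr \<beta> * t) * (indicator {0<..} x *\<^sub>R (exp (- (s + \<mu>) * x) * f x t)))
      (exp (\<mu> powr \<beta> * t) * exp (- t * (s + \<mu>) powr \<beta>))"
    by simp
  moreover have "(\<lambda>x. exp (\<mu> powr \<beta> * t) * (indicator {0<..} x *\<^sub>R (exp (- (s + \<mu>) * x) * f x t)))
      = (\<lambda>x. indicator {0<..} x *\<^sub>R (exp (- s * x) * tempered_density \<mu> \<beta> f x t))"
  proof
    fix x :: real
    have "exp (\<mu> powr \<beta> * t) * exp (- (s + \<mu>) * x) = exp (- s * x) * exp (- \<mu> * x + \<mu> powr \<beta> * t)"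
      unfolding exp_add[symmetric] by (rule arg_cong[where f = exp]) (simp add: algebra_simps)
    then show "exp (\<mu> powr \<beta> * t) * (indicator {0<..} x *\<^sub>R (exp (- (s + \<mu>) * x) * f x t))
        = indicator {0<..} x *\<^sub>R (exp (- s * x) * tempered_density \<mu> \<beta> f x t)"
      unfolding tempered_density_def real_scaleR_def
      by (simp only: mult.assoc[symmetric] mult.commute[of _ "indicator {0<..} x"])
        (simp only: mult.assoc)
  qed
  moreover have "exp (\<mu> powr \<beta> * t) * exp (- t * (s + \<mu>) powr \<beta>)
      = exp (- t * ((s + \<mu>) powr \<beta> - \<mu> powr \<beta>))"
    unfolding exp_add[symmetric] by (rule arg_cong[where f = exp]) (simp add: algebra_simps)
  ultimately show ?thesis by simp
qed

end

theory Submission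
  imports Defs "HOL-Complex_Analysis.Complex_Analysis"
begin

text \<open>By analytic continuation of the Laplace transform to the right half-plane, \<open>f\<^sub>\<mu>(\<sqdot>, t)\<close> is a
  probability density with characteristic function \<open>exp (- t \<psi>(\<xi>))\<close>, where
  \<open>\<psi>(\<xi>) = (\<mu> - \<i>\<xi>)\<^sup>\<beta> - \<mu>\<^sup>\<beta>\<close>. Since \<open>Re \<psi>\<close> grows like \<open>\<bar>\<xi>\<bar>\<^sup>\<beta>\<close>, Fourier inversion gives
  \<open>2\<pi> f\<^sub>\<mu>(x, t) = \<integral> exp (- \<i>\<xi>x - t \<psi>(\<xi>)) d\<xi>\<close>, and one may differentiate under the integral sign:
  \<open>\<partial>/\<partial>t\<close> becomes multiplication by \<open>- \<psi>\<close> and \<open>\<partial>/\<partial>x\<close> multiplication by \<open>- \<i>\<xi>\<close>. For \<open>\<beta> = 1/m\<close> the equation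
  is then the binomial expansion of \<open>(\<psi> + \<mu>\<^sup>\<beta>)\<^sup>m = \<mu> - \<i>\<xi>\<close>.\<close>

section \<open>Differentiation under the integral sign\<close>

text \<open>The mean value inequality on the convex set \<open>S\<close> turns the bound on
  \<open>F'\<close> into a Lipschitz bound with constant \<open>\<bar>B y\<bar>\<close>. The
  normalised remainders are then dominated by \<open>2 * \<bar>B y\<bar>\<close>, and dominated
  convergence applies. The Frechet form serves complex and real parameters alike.\<close>

lemma has_derivative_integral:
  fixes F :: "'p::real_normed_vector \<Rightarrow> 'b \<Rightarrow> 'a::{banach, second_countable_topology}"
  assumes S: "open S" "convex S" "r0 \<in> S"
    and F: "\<And>r. r \<in> S \<Longrightarrow> integrable M (F r)"
    and D: "\<And>r y. r \<in> S \<Longrightarrow> y \<in> space M \<Longrightarrow> ((\<lambda>r. F r y) has_derivative F' r y) (at r)"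
    and meas: "\<And>v. (\<lambda>y. F' r0 y v) \<in> borel_measurable M"
    and B: "integrable M B"
      "\<And>r y v. r \<in> S \<Longrightarrow> y \<in> space M \<Longrightarrow> norm (F' r y v) \<le> B y * norm v"
  shows "((\<lambda>r. \<integral>y. F r y \<partial>M) has_derivative (\<lambda>v. \<integral>y. F' r0 y v \<partial>M)) (at r0)"
proof -
  have int': "integrable M (\<lambda>y. F' r0 y v)" for v
  proof (rule Bochner_Integration.integrable_bound)
    show "integrable M (\<lambda>y. B y * norm v)" using B(1) by simp
    show "AE y in M. norm (F' r0 y v) \<le> norm (B y * norm v)"
      using B(2)[OF S(3)] by (intro AE_I2) (smt (verit) real_norm_def)
  qed (rule meas)
  have lin: "bounded_linear (F' r0 y)" if "y \<in> space M" for y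
    using D[OF S(3) that] by (rule has_derivative_bounded_linear)
  have bl: "bounded_linear (\<lambda>v. \<integral>y. F' r0 y v \<partial>M)"
  proof
    fix u v
    have "(\<integral>y. F' r0 y (u + v) \<partial>M) = (\<integral>y. F' r0 y u + F' r0 y v \<partial>M)"
      using lin by (intro Bochner_Integration.integral_cong) (auto simp: linear_add bounded_linear.linear)
    then show "(\<integral>y. F' r0 y (u + v) \<partial>M) = (\<integral>y. F' r0 y u \<partial>M) + (\<integral>y. F' r0 y v \<partial>M)"
      using int' by simp
  next
    fix c v
    have "(\<integral>y. F' r0 y (c *\<^sub>R v) \<partial>M) = (\<integral>y. c *\<^sub>R F' r0 y v \<partial>M)"
      using lin by (intro Bochner_Integration.integral_cong) (auto simp: linear_cmul bounded_linear.linear)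
    then show "(\<integral>y. F' r0 y (c *\<^sub>R v) \<partial>M) = c *\<^sub>R (\<integral>y. F' r0 y v \<partial>M)" by simp
  next
    have "norm (\<integral>y. F' r0 y v \<partial>M) \<le> norm v * (\<integral>y. B y \<partial>M)" for v
    proof -
      have "norm (\<integral>y. F' r0 y v \<partial>M) \<le> (\<integral>y. norm (F' r0 y v) \<partial>M)"
        by (rule integral_norm_bound)
      also have "\<dots> \<le> (\<integral>y. B y * norm v \<partial>M)"
        using int' B S by (intro integral_mono) auto
      finally show ?thesis by (simp add: mult.commute)
    qed
    then show "\<exists>K. \<forall>v. norm (\<integral>y. F' r0 y v \<partial>M) \<le> norm v * K" by blast
  qed
  \<comment> \<open>In a trivial parameter space the bound does not force
    \<open>B y \<ge> 0\<close>; the absolute value supplies the nonnegative constant that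
    \<open>onorm_bound\<close> asks for.\<close>
  have B': "norm (F' r y v) \<le> \<bar>B y\<bar> * norm v" if "r \<in> S" "y \<in> space M" for r y v
    using B(2)[OF that, of v] by (meson abs_ge_self mult_right_mono norm_ge_zero order_trans)
  have lip: "norm (F r y - F r0 y) \<le> \<bar>B y\<bar> * norm (r - r0)" if "r \<in> S" "y \<in> space M" for r y
  proof (rule differentiable_bound[OF S(2)])
    show "((\<lambda>r. F r y) has_derivative F' r y) (at r within S)" if "r \<in> S" for r
      using D[OF that \<open>y \<in> space M\<close>] by (rule has_derivative_at_withinI)
    show "onorm (F' r y) \<le> \<bar>B y\<bar>" if r: "r \<in> S" for r
    proof (rule onorm_bound)
      show "norm (F' r y v) \<le> \<bar>B y\<bar> * norm v" for v by (rule B'[OF r \<open>y \<in> space M\<close>])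
    qed simp
  qed (use that S in auto)
  \<comment> \<open>Dominated convergence is a statement about sequences, so the limit is tested
    along sequences in \<open>S - {r0}\<close>. Since \<open>S\<close> is open, this is the full
    limit at \<open>r0\<close>.\<close>
  have "((\<lambda>r. norm ((\<integral>y. F r y \<partial>M) - (\<integral>y. F r0 y \<partial>M) - (\<integral>y. F' r0 y (r - r0) \<partial>M)) / norm (r - r0))
      \<longlongrightarrow> 0) (at r0 within S)"
    unfolding tendsto_at_iff_sequentially comp_def
  proof (intro allI impI)
    fix X assume X: "\<forall>i. X i \<in> S - {r0}" "X \<longlonglongrightarrow> r0"
    define G where "G i y = (F (X i) y - F r0 y - F' r0 y (X i - r0)) /\<^sub>R norm (X i - r0)" for i y
    have [measurable]: "F r0 \<in> borel_measurable M" "F (X i) \<in> borel_measurable M"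
      "(\<lambda>y. F' r0 y v) \<in> borel_measurable M" for i v
      using F S X meas by auto
    have "(\<lambda>i. \<integral>y. G i y \<partial>M) \<longlonglongrightarrow> (\<integral>y. 0 \<partial>M)"
    proof (rule integral_dominated_convergence[where w = "\<lambda>y. 2 * \<bar>B y\<bar>"])
      show "G i \<in> borel_measurable M" for i unfolding G_def by measurable
      show "AE y in M. (\<lambda>i. G i y) \<longlonglongrightarrow> 0"
      proof (rule AE_I2)
        fix y assume "y \<in> space M"
        from D[OF S(3) this] have "((\<lambda>r. norm ((F r y - F r0 y - F' r0 y (r - r0)) /\<^sub>R norm (r - r0))) \<longlongrightarrow> 0) (at r0)"
          by (simp add: has_derivative_iff_norm divide_inverse mult.commute)
        then have "((\<lambda>r. (F r y - F r0 y - F' r0 y (r - r0)) /\<^sub>R norm (r - r0)) \<longlongrightarrow> 0) (at r0)"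
          by (rule tendsto_norm_zero_cancel)
        then show "(\<lambda>i. G i y) \<longlonglongrightarrow> 0"
          using X unfolding tendsto_at_iff_sequentially comp_def G_def by auto
      qed
      show "AE y in M. norm (G i y) \<le> 2 * \<bar>B y\<bar>" for i
      proof (rule AE_I2)
        fix y assume y: "y \<in> space M"
        have "norm (F (X i) y - F r0 y - F' r0 y (X i - r0)) \<le> 2 * \<bar>B y\<bar> * norm (X i - r0)"
          using lip[OF _ y, of "X i"] B'[OF S(3) y, of "X i - r0"] X
            norm_triangle_ineq4[of "F (X i) y - F r0 y" "F' r0 y (X i - r0)"] by fastforce
        then show "norm (G i y) \<le> 2 * \<bar>B y\<bar>"
          using X by (simp add: G_def pos_divide_le_eq flip: divide_inverse_commute)
      qed
    qed (use B(1) in auto)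
    moreover have "(\<integral>y. G i y \<partial>M) =
        ((\<integral>y. F (X i) y \<partial>M) - (\<integral>y. F r0 y \<partial>M) - (\<integral>y. F' r0 y (X i - r0) \<partial>M)) /\<^sub>R norm (X i - r0)" for i
      unfolding G_def using F S X int' by simp
    ultimately have "(\<lambda>i. norm (((\<integral>y. F (X i) y \<partial>M) - (\<integral>y. F r0 y \<partial>M) - (\<integral>y. F' r0 y (X i - r0) \<partial>M)) /\<^sub>R norm (X i - r0))) \<longlonglongrightarrow> norm (0::'a)"
      by (intro tendsto_norm) simp
    then show "(\<lambda>i. norm ((\<integral>y. F (X i) y \<partial>M) - (\<integral>y. F r0 y \<partial>M) - (\<integral>y. F' r0 y (X i - r0) \<partial>M)) / norm (X i - r0)) \<longlonglongrightarrow> 0"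
      by (simp add: divide_inverse mult.commute)
  qed
  then show ?thesis
    using bl by (simp add: has_derivative_iff_norm at_within_open[OF S(3,1)])
qed

lemma has_field_derivative_integral:
  fixes F :: "'a::{real_normed_field, banach, second_countable_topology} \<Rightarrow> 'b \<Rightarrow> 'a"
  assumes "open S" "convex S" "r0 \<in> S"
    and "\<And>r. r \<in> S \<Longrightarrow> integrable M (F r)"
    and "\<And>r y. r \<in> S \<Longrightarrow> y \<in> space M \<Longrightarrow> ((\<lambda>r. F r y) has_field_derivative F' r y) (at r)"
    and [measurable]: "F' r0 \<in> borel_measurable M"
    and "integrable M B" "\<And>r y. r \<in> S \<Longrightarrow> y \<in> space M \<Longrightarrow> norm (F' r y) \<le> B y"
  shows "((\<lambda>r. \<integral>y. F r y \<partial>M) has_field_derivative (\<integral>y. F' r0 y \<partial>M)) (at r0)"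
proof -
  have "((\<lambda>r. \<integral>y. F r y \<partial>M) has_derivative (\<lambda>v. \<integral>y. F' r0 y * v \<partial>M)) (at r0)"
    using assms by (intro has_derivative_integral[where S = S and B = B])
      (auto simp: has_field_derivative_def norm_mult mult_right_mono)
  then show ?thesis by (simp add: has_field_derivative_def)
qed

text \<open>The version for a real parameter and complex values, as needed for derivatives in
  \<open>x\<close> and \<open>t\<close>.\<close>

lemma has_vector_derivative_integral:
  fixes F :: "real \<Rightarrow> 'b \<Rightarrow> 'a::{banach, second_countable_topology}"
  assumes "open S" "convex S" "r0 \<in> S"
    and "\<And>r. r \<in> S \<Longrightarrow> integrable M (F r)"
    and "\<And>r y. r \<in> S \<Longrightarrow> y \<in> space M \<Longrightarrow> ((\<lambda>r. F r y) has_vector_derivative F' r y) (at r)"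
    and [measurable]: "F' r0 \<in> borel_measurable M"
    and "integrable M B" "\<And>r y. r \<in> S \<Longrightarrow> y \<in> space M \<Longrightarrow> norm (F' r y) \<le> B y"
  shows "((\<lambda>r. \<integral>y. F r y \<partial>M) has_vector_derivative (\<integral>y. F' r0 y \<partial>M)) (at r0)"
proof -
  have "((\<lambda>r. \<integral>y. F r y \<partial>M) has_derivative (\<lambda>v. \<integral>y. v *\<^sub>R F' r0 y \<partial>M)) (at r0)"
    using assms by (intro has_derivative_integral[where S = S and B = B])
      (auto simp: has_vector_derivative_def mult.commute[of _ "\<bar>_\<bar>"] mult_left_mono)
  then show ?thesis by (simp add: has_vector_derivative_def)
qed

section \<open>Fourier inversion for a density with integrable characteristic function\<close>

text \<open>Integrability of the characteristic function makes the integral in Levy's formula absolutely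
  convergent, and the formula can be differentiated in the upper endpoint.\<close>

lemma density_eq_integral_char:
  fixes h :: "real \<Rightarrow> real"
  defines "M \<equiv> density lborel (\<lambda>y. ennreal (h y))"
  assumes M: "prob_space M" and h: "h \<in> borel_measurable borel" "\<And>y. 0 \<le> h y"
    and char: "integrable lborel (char M)"
    and U: "open U" "x \<in> U" "continuous_on U h"
  shows "complex_of_real (h x) = 1 / (2 * pi) * (CLBINT \<xi>. iexp (- (\<xi> * x)) * char M \<xi>)"
proof -
  note [measurable] = h(1)
  interpret prob_space M by (rule M)
  interpret real_distribution M by standard (auto simp: M_def)
  obtain e where e: "e > 0" "cball x e \<subseteq> U" using U open_contains_cball by blast
  \<comment> \<open>A density extended by zero may jump elsewhere, so the argument stays in a
    compact interval around \<open>x\<close> inside \<open>U\<close>.\<close>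
  define a b where "a = x - e" and "b = x + e"
  have ab: "a < x" "x < b" "{a..b} \<subseteq> U"
    using e by (auto simp: a_def b_def cball_eq_atLeastAtMost)
  have cont: "continuous_on {a..b} h" using U(3) ab(3) by (rule continuous_on_subset)
  \<comment> \<open>The integrand of Levy's formula for the interval from \<open>a\<close> to
    \<open>u\<close>; differentiating it in \<open>u\<close> produces the Fourier integrand.\<close>
  define K where "K u \<xi> = (iexp (-(\<xi> * a)) - iexp (-(\<xi> * u))) / (\<i> * \<xi>) * char M \<xi>" for u \<xi> :: real
  have [measurable]: "K u \<in> borel_measurable borel" for u
    unfolding K_def by measurable
  \<comment> \<open>The quotient is the integral of \<open>iexp (- (\<xi> * y))\<close> over
    \<open>y\<close> between \<open>a\<close> and \<open>u\<close>. The two orderings of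
    \<open>a\<close> and \<open>u\<close> are treated separately because the library bound assumes
    ordered endpoints.\<close>
  have K_bound: "norm (K u \<xi>) \<le> \<bar>u - a\<bar> * norm (char M \<xi>)" for u \<xi>
  proof (cases "\<xi> = 0")
    case False
    have "norm ((iexp (-(\<xi> * a)) - iexp (-(\<xi> * u))) / (\<i> * \<xi>)) \<le> \<bar>u - a\<bar>"
    proof (cases "a \<le> u")
      case True
      then show ?thesis using Levy_Inversion_aux2[of "-u" "-a" \<xi>] False by simp
    next
      case F: False
      then show ?thesis using Levy_Inversion_aux2[of "-a" "-u" \<xi>] False
        by (simp add: norm_divide norm_minus_commute)
    qed
    then show ?thesis unfolding K_def norm_mult by (rule mult_right_mono) simp
  qed (simp add: K_def)
  have K_int: "integrable lborel (K u)" for u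
  proof (rule Bochner_Integration.integrable_bound)
    show "integrable lborel (\<lambda>\<xi>. \<bar>u - a\<bar> * norm (char M \<xi>))" using char by simp
  qed (use K_bound in auto)
  \<comment> \<open>Levy's formula requires both endpoints of the interval to carry no mass.\<close>
  have sing: "measure M {y} = 0" for y
    unfolding M_def measure_def by (simp add: emeasure_density nn_integral_indicator_singleton)
  have P: "complex_of_real (measure M {a<..u}) = 1 / (2 * pi) * (CLBINT \<xi>. K u \<xi>)" if "a \<le> u" for u
  proof -
    have "(\<lambda>T. CLBINT \<xi>. indicator {-real T<..<real T} \<xi> *\<^sub>R K u \<xi>) \<longlonglongrightarrow> (CLBINT \<xi>. K u \<xi>)"
    proof (rule integral_dominated_convergence[where w = "\<lambda>\<xi>. norm (K u \<xi>)"])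
      show "AE \<xi> in lborel. (\<lambda>T. indicator {-real T<..<real T} \<xi> *\<^sub>R K u \<xi>) \<longlonglongrightarrow> K u \<xi>"
      proof (rule AE_I2)
        fix \<xi> :: real
        have "eventually (\<lambda>T. indicator {-real T<..<real T} \<xi> *\<^sub>R K u \<xi> = K u \<xi>) sequentially"
          using eventually_gt_at_top[of "nat \<lceil>\<bar>\<xi>\<bar>\<rceil>"]
          by eventually_elim (auto simp: indicator_def; linarith)
        then show "(\<lambda>T. indicator {-real T<..<real T} \<xi> *\<^sub>R K u \<xi>) \<longlonglongrightarrow> K u \<xi>"
          by (rule tendsto_eventually)
      qed
    qed (use K_int[of u] in \<open>auto simp: indicator_def\<close>)
    moreover have "(CLBINT \<xi>=-real T..real T. K u \<xi>) = (CLBINT \<xi>. indicator {-real T<..<real T} \<xi> *\<^sub>R K u \<xi>)" for T :: nat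
      by (simp add: interval_lebesgue_integral_def set_lebesgue_integral_def)
    ultimately have "(\<lambda>T. 1 / (2 * pi) * (CLBINT \<xi>=-real T..real T. K u \<xi>)) \<longlonglongrightarrow> 1 / (2 * pi) * (CLBINT \<xi>. K u \<xi>)"
      by (intro tendsto_mult tendsto_const) simp
    moreover have "(\<lambda>T. 1 / (2 * pi) * (CLBINT \<xi>=-real T..real T. K u \<xi>)) \<longlonglongrightarrow> complex_of_real (measure M {a<..u})"
      using Levy_Inversion[OF that sing sing] unfolding K_def by simp
    ultimately show ?thesis by (rule LIMSEQ_unique[symmetric])
  qed
  have cdf: "measure M {a<..u} = (LBINT y=a..u. h y)" if "u \<in> {a..b}" for u
  proof -
    have "set_integrable lborel {a..u} h"
      using cont that by (intro borel_integrable_atLeastAtMost') (auto elim: continuous_on_subset)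
    then have int: "set_integrable lborel {a<..u} h"
      by (rule set_integrable_subset) auto
    have "measure M {a<..u} = enn2real (\<integral>\<^sup>+ y. ennreal (indicator {a<..u} y * h y) \<partial>lborel)"
      unfolding M_def measure_def
      by (subst emeasure_density) (auto intro!: arg_cong[where f = enn2real] nn_integral_cong simp: indicator_def)
    also have "\<dots> = (LBINT y:{a<..u}. h y)"
      using int h(2) by (subst nn_integral_eq_integral)
        (auto simp: set_integrable_def set_lebesgue_integral_def intro!: integral_nonneg_AE)
    also have "\<dots> = (LBINT y=a..u. h y)"
      using that by (simp add: interval_integral_Ioc)
    finally show ?thesis .
  qed
  have "((\<lambda>u. LBINT y=a..u. h y) has_vector_derivative h x) (at x within {a..b})"
    using ab cont by (intro interval_integral_FTC2) auto
  then have "((\<lambda>u. complex_of_real (LBINT y=a..u. h y)) has_vector_derivative complex_of_real (h x)) (at x within {a..b})"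
    by (rule bounded_linear.has_vector_derivative[OF bounded_linear_of_real])
  \<comment> \<open>The two sides are known to agree only for \<open>u\<close> in
    \<open>{a..b}\<close>, so the derivative is transferred within that interval; \<open>x\<close>
    is interior, which gives the full derivative.\<close>
  then have "((\<lambda>u. 1 / (2 * pi) * (CLBINT \<xi>. K u \<xi>)) has_vector_derivative complex_of_real (h x)) (at x within {a..b})"
    by (rule has_vector_derivative_transform[rotated 2]) (use ab P in \<open>simp_all flip: cdf\<close>)
  then have D1: "((\<lambda>u. 1 / (2 * pi) * (CLBINT \<xi>. K u \<xi>)) has_vector_derivative complex_of_real (h x)) (at x)"
    unfolding at_within_Icc_at[OF ab(1,2)] .
  \<comment> \<open>\<open>K u 0 = 0\<close> for all \<open>u\<close>, because division by zero yields zero.\<close>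
  define K' where "K' u \<xi> = (if \<xi> = 0 then 0 else iexp (- (\<xi> * u)) * char M \<xi>)" for u \<xi> :: real
  have "((\<lambda>u. CLBINT \<xi>. K u \<xi>) has_vector_derivative (CLBINT \<xi>. K' x \<xi>)) (at x)"
  proof (rule has_vector_derivative_integral[where S = UNIV and B = "\<lambda>\<xi>. norm (char M \<xi>)"])
    show "((\<lambda>u. K u \<xi>) has_vector_derivative K' u \<xi>) (at u)" for u \<xi>
    proof (cases "\<xi> = 0")
      case False
      then have "((\<lambda>z. (iexp (-(\<xi> * a)) - exp (- \<i> * \<xi> * z)) / (\<i> * \<xi>) * char M \<xi>) has_field_derivative
          exp (- \<i> * \<xi> * u) * char M \<xi>) (at (complex_of_real u))"
        by (auto intro!: derivative_eq_intros simp: field_simps)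
      from has_vector_derivative_real_field[OF this, of UNIV] False show ?thesis
        by (simp add: K_def K'_def mult.assoc)
    qed (simp add: K_def K'_def)
  qed (use K_int char in \<open>auto simp: K'_def norm_mult\<close>)
  then have "((\<lambda>u. 1 / (2 * pi) * (CLBINT \<xi>. K u \<xi>)) has_vector_derivative 1 / (2 * pi) * (CLBINT \<xi>. K' x \<xi>)) (at x)"
    by (rule has_vector_derivative_mult_right)
  from vector_derivative_unique_at[OF D1 this]
  have "complex_of_real (h x) = 1 / (2 * pi) * (CLBINT \<xi>. K' x \<xi>)" .
  \<comment> \<open>The integrands differ only at \<open>\<xi> = 0\<close>, a null set.\<close>
  also have "(CLBINT \<xi>. K' x \<xi>) = (CLBINT \<xi>. iexp (- (\<xi> * x)) * char M \<xi>)"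
    by (intro integral_cong_AE AE_I[of _ _ "{0}"]) (auto simp: K'_def)
  finally show ?thesis .
qed

section \<open>Laplace transforms on the right half-plane\<close>

text \<open>A single term of the exponential series of \<open>c * y\<close> is at most the whole
  sum. This trades polynomial growth for a constant.\<close>

lemma power_mult_exp_le:
  fixes c y :: real
  assumes "0 < c" "0 \<le> y"
  shows "y ^ n * exp (- c * y) \<le> fact n / c ^ n"
proof -
  have "(\<Sum>k\<in>{n}. (c * y) ^ k /\<^sub>R fact k) \<le> exp (c * y)"
    unfolding exp_def using assms
    by (intro sum_le_suminf summable_exp_generic) (auto simp: field_simps)
  then show ?thesis
    using assms by (simp add: field_simps power_mult_distrib exp_minus)
qed

text \<open>Differentiation in \<open>s\<close> brings down a factor \<open>- x\<close>, which
  \<open>exp (- d * x)\<close> absorbs at the cost of a constant \<open>1 / d\<close>, uniformly for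
  \<open>Re s > d\<close>.\<close>

lemma holomorphic_laplace_integral:
  fixes h :: "real \<Rightarrow> complex"
  assumes h: "integrable lborel h" "\<And>x. x \<le> 0 \<Longrightarrow> h x = 0"
  shows "(\<lambda>s. CLBINT x. exp (- s * complex_of_real x) * h x) holomorphic_on {s. 0 < Re s}"
proof (rule holomorphic_onI)
  fix s0 assume "s0 \<in> {s. 0 < Re s}"
  then have s0: "0 < Re s0" by simp
  \<comment> \<open>Halving leaves \<open>s0\<close> inside the half-plane \<open>d < Re s\<close>
    while keeping that half-plane away from the imaginary axis.\<close>
  define d where "d = Re s0 / 2"
  have d: "0 < d" "d < Re s0" using s0 by (auto simp: d_def)
  have [measurable]: "h \<in> borel_measurable borel"
    using h(1) by simp
  have le1: "norm (exp (- s * complex_of_real x) * h x) \<le> norm (h x)" if "Re s > d" for s x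
  proof (cases "x \<le> 0")
    case False
    then show ?thesis using that d
      by (auto simp: norm_mult intro!: mult_left_le_one_le)
  qed (simp add: h)
  have le2: "norm (- complex_of_real x * exp (- s * complex_of_real x) * h x) \<le> 1 / d * norm (h x)"
    if "Re s > d" for s x
  proof (cases "x \<le> 0")
    case False
    then have "\<bar>x\<bar> * exp (- (Re s * x)) \<le> x * exp (- d * x)"
      using that by (intro mult_mono) auto
    also have "\<dots> \<le> 1 / d" using power_mult_exp_le[of d x 1] d False by simp
    finally show ?thesis unfolding norm_mult by (intro mult_right_mono) auto
  qed (simp add: h)
  have "((\<lambda>s. CLBINT x. exp (- s * complex_of_real x) * h x) has_field_derivative
      (CLBINT x. - complex_of_real x * exp (- s0 * complex_of_real x) * h x)) (at s0)"
  proof (rule has_field_derivative_integral[where S = "{s. d < Re s}" and B = "\<lambda>x. 1 / d * norm (h x)"])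
    show "integrable lborel (\<lambda>x. exp (- s * complex_of_real x) * h x)" if "s \<in> {s. d < Re s}" for s
      using that le1 by (intro Bochner_Integration.integrable_bound[OF h(1)]) auto
  qed (use d h le2 in \<open>auto simp: open_halfspace_Re_gt convex_halfspace_Re_gt intro!: derivative_eq_intros\<close>)
  then show "(\<lambda>s. CLBINT x. exp (- s * complex_of_real x) * h x) field_differentiable at s0 within {s. 0 < Re s}"
    by (meson field_differentiable_at_within field_differentiable_def)
qed

text \<open>Both sides are holomorphic for \<open>0 < Re s\<close>, where the principal power avoids
  its branch cut, and they agree on the positive reals, which accumulate at 1. The identity theorem
  does the rest.\<close>

lemma stable_subordinator_complex_laplace:
  assumes f: "stable_subordinator_density \<beta> f" and t: "0 < t" and s: "0 < Re s"
  shows "(CLBINT x. exp (- s * complex_of_real x) * complex_of_real (indicator {0<..} x * f x t))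
    = exp (- t * s powr complex_of_real \<beta>)" (is "?L s = ?R s")
proof -
  have L: "has_bochner_integral lborel (\<lambda>x. indicator {0<..} x *\<^sub>R (exp (- r * x) * f x t)) (exp (- t * r powr \<beta>))"
    if "0 \<le> r" for r
    using f t that unfolding stable_subordinator_density_def by blast
  \<comment> \<open>The Laplace transform at 0 provides integrability of the density itself.\<close>
  have int: "integrable lborel (\<lambda>x. complex_of_real (indicator {0<..} x * f x t))"
    using L[of 0] by (intro integrable_of_real) (simp add: has_bochner_integral_iff)
  have hol: "?L holomorphic_on {s. 0 < Re s}"
    by (rule holomorphic_laplace_integral[OF int]) simp
  have "?L s - ?R s = 0"
  proof (rule analytic_continuation[where f = "\<lambda>s. ?L s - ?R s" and w = s and S = "{s. 0 < Re s}" and U = "complex_of_real ` {0<..}" and \<xi> = 1])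
    show "(\<lambda>s. ?L s - ?R s) holomorphic_on {s. 0 < Re s}"
      using hol by (intro holomorphic_intros) (auto simp: complex_nonpos_Reals_iff)
    show "connected {s. 0 < Re s}" by (simp add: convex_connected convex_halfspace_Re_gt)
    show "(1::complex) islimpt complex_of_real ` {0<..}"
      unfolding islimpt_approachable
    proof (intro allI impI)
      fix e :: real assume "e > 0"
      then show "\<exists>x'\<in>complex_of_real ` {0<..}. x' \<noteq> 1 \<and> dist x' 1 < e"
        by (intro bexI[of _ "complex_of_real (1 + e / 2)"] imageI) (auto simp: dist_norm)
    qed
    show "?L z - ?R z = 0" if "z \<in> complex_of_real ` {0<..}" for z
    proof -
      obtain r where r: "0 < r" "z = complex_of_real r" using \<open>z \<in> _\<close> by auto
      have "?L z = (CLBINT x. complex_of_real (indicator {0<..} x *\<^sub>R (exp (- r * x) * f x t)))"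
        using r by (intro Bochner_Integration.integral_cong) (auto simp flip: exp_of_real)
      also have "\<dots> = complex_of_real (LBINT x. indicator {0<..} x *\<^sub>R (exp (- r * x) * f x t))"
        by (rule integral_complex_of_real)
      also have "\<dots> = complex_of_real (exp (- t * r powr \<beta>))"
        using has_bochner_integral_integral_eq[OF L[of r]] r by simp
      also have "\<dots> = ?R z"
        using r by (simp add: powr_of_real flip: exp_of_real)
      finally show ?thesis by simp
    qed
  qed (use s in \<open>auto simp: open_halfspace_Re_gt\<close>)
  then show ?thesis by simp
qed

section \<open>The characteristic exponent: algebra and growth\<close>

text \<open>The stable Laplace exponent \<open>s powr \<beta>\<close>, principal branch, on the
  vertical line \<open>Re s = \<mu>\<close>.\<close>

definition root_symbol :: "real \<Rightarrow> nat \<Rightarrow> real \<Rightarrow> complex" where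
  "root_symbol \<mu> m \<xi> = (complex_of_real \<mu> - \<i> * \<xi>) powr complex_of_real (1 / real m)"

definition tempered_exponent :: "real \<Rightarrow> nat \<Rightarrow> real \<Rightarrow> complex" where
  "tempered_exponent \<mu> m \<xi> = root_symbol \<mu> m \<xi> - complex_of_real (\<mu> powr (1 / real m))"

text \<open>The integrand of the inverse Fourier transform, without the factor
  \<open>1 / (2 * pi)\<close>.\<close>

definition tempered_kernel :: "real \<Rightarrow> nat \<Rightarrow> real \<Rightarrow> real \<Rightarrow> real \<Rightarrow> complex" where
  "tempered_kernel \<mu> m x t \<xi> = iexp (- (\<xi> * x)) * exp (- complex_of_real t * tempered_exponent \<mu> m \<xi>)"

context
  fixes \<mu> :: real and m :: nat
  assumes \<mu>: "0 < \<mu>" and m: "2 \<le> m"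
begin

lemma measurable_root_symbol [measurable]: "root_symbol \<mu> m \<in> borel_measurable borel"
proof (rule borel_measurable_continuous_onI)
  show "continuous_on UNIV (root_symbol \<mu> m)"
    unfolding root_symbol_def using \<mu> m
    by (intro continuous_intros) (auto simp: complex_nonpos_Reals_iff)
qed

lemma measurable_tempered_exponent [measurable]: "tempered_exponent \<mu> m \<in> borel_measurable borel"
  unfolding tempered_exponent_def by measurable

lemma base_neq_0: "complex_of_real \<mu> - \<i> * complex_of_real \<xi> \<noteq> 0"
  using \<mu> by (auto simp: complex_eq_iff)

text \<open>The power is \<open>exp (Ln z / m)\<close>, so its \<open>m\<close>-th power undoes the
  logarithm. This is where \<open>\<beta> = 1 / m\<close> with integral \<open>m\<close>
  enters.\<close>

lemma root_symbol_power: "root_symbol \<mu> m \<xi> ^ m = complex_of_real \<mu> - \<i> * \<xi>"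
  unfolding root_symbol_def using base_neq_0 m
  by (simp add: powr_def flip: exp_of_nat_mult)

lemma norm_root_symbol_power: "norm (root_symbol \<mu> m \<xi>) ^ m = norm (complex_of_real \<mu> - \<i> * \<xi>)"
  by (metis norm_power root_symbol_power)

lemma norm_root_symbol_pos: "0 < norm (root_symbol \<mu> m \<xi>)"
  using base_neq_0 by (simp add: root_symbol_def)

text \<open>The norm of the base is at least its real part \<open>\<mu>\<close>. Hence the constant
  subtracted in \<open>tempered_exponent\<close> never exceeds the norm of the symbol, and all
  growth can be measured by that norm.\<close>

lemma le_norm_root_symbol: "\<mu> powr (1 / real m) \<le> norm (root_symbol \<mu> m \<xi>)"
proof -
  have "\<mu> \<le> norm (complex_of_real \<mu> - \<i> * \<xi>)"
    using complex_Re_le_cmod[of "complex_of_real \<mu> - \<i> * \<xi>"] by simp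
  then have "\<mu> powr (1 / real m) \<le> norm (complex_of_real \<mu> - \<i> * \<xi>) powr (1 / real m)"
    using \<mu> by (intro powr_mono2) auto
  then show ?thesis by (simp add: root_symbol_def norm_powr_real_powr')
qed

lemma norm_tempered_exponent_le: "norm (tempered_exponent \<mu> m \<xi>) \<le> 2 * norm (root_symbol \<mu> m \<xi>)"
  using norm_triangle_ineq4[of "root_symbol \<mu> m \<xi>" "complex_of_real (\<mu> powr (1 / real m))"]
    le_norm_root_symbol[of \<xi>] by (simp add: tempered_exponent_def)

text \<open>The argument of \<open>\<mu> - \<i>\<xi>\<close> lies in \<open>(-\<pi>/2, \<pi>/2)\<close>, so that of its \<open>m\<close>-th root is at
  most \<open>\<pi>/4 < \<pi>/3\<close> in absolute value.\<close>

lemma Re_root_symbol_ge: "norm (root_symbol \<mu> m \<xi>) / 2 \<le> Re (root_symbol \<mu> m \<xi>)"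
proof -
  let ?z = "complex_of_real \<mu> - \<i> * \<xi>"
  have 1: "\<bar>Im (Ln ?z)\<bar> < pi / 2"
    using \<mu> by (intro Re_Ln_pos_lt_imp) auto
  have eq: "root_symbol \<mu> m \<xi> = exp (complex_of_real (1 / real m) * Ln ?z)"
    using base_neq_0 by (simp add: root_symbol_def powr_def)
  let ?\<theta> = "Im (Ln ?z) / real m"
  have "\<bar>?\<theta>\<bar> \<le> pi / 3"
  proof -
    have "\<bar>?\<theta>\<bar> = \<bar>Im (Ln ?z)\<bar> / real m" by simp
    also have "\<dots> \<le> (pi / 2) / 2" using 1 m by (intro frac_le) auto
    also have "\<dots> \<le> pi / 3" by simp
    finally show ?thesis .
  qed
  then have "cos (pi / 3) \<le> cos \<bar>?\<theta>\<bar>"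
    by (intro cos_monotone_0_pi_le) auto
  then have "1 / 2 \<le> cos ?\<theta>" by (simp only: cos_60 cos_abs_real)
  then show ?thesis
    unfolding eq by (simp add: Re_exp)
qed

text \<open>Let \<open>w\<close> be the norm of the symbol. The real part is at least
  \<open>w / 2\<close>, so there is exponential decay in \<open>w\<close>. Since
  \<open>w ^ (2 * m) = \<mu>\<^sup>2 + \<xi>\<^sup>2\<close>, giving up \<open>2 * m\<close> powers
  of \<open>w\<close> leaves quadratic decay in \<open>\<xi>\<close>.\<close>

lemma integrable_symbol_power_exp:
  assumes c: "0 < c"
  shows "integrable lborel (\<lambda>\<xi>. norm (root_symbol \<mu> m \<xi>) ^ n * exp (- c * Re (root_symbol \<mu> m \<xi>)))"
proof -
  define N where "N = n + 2 * m"
  \<comment> \<open>The last factor pays for replacing \<open>\<mu>\<^sup>2 + \<xi>\<^sup>2\<close>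
    by \<open>1 + \<xi>\<^sup>2\<close>.\<close>
  define A where "A = fact N / (c / 2) ^ N * (1 + 1 / \<mu>\<^sup>2)"
  have "integrable lborel (\<lambda>\<xi>::real. A * inverse (1 + \<xi>\<^sup>2))"
    using integrable_inverse_1_plus_square by (simp add: set_integrable_def)
  then show ?thesis
  proof (rule Bochner_Integration.integrable_bound)
    show "AE \<xi> in lborel. norm (norm (root_symbol \<mu> m \<xi>) ^ n * exp (- c * Re (root_symbol \<mu> m \<xi>)))
        \<le> norm (A * inverse (1 + \<xi>\<^sup>2))"
    proof (rule AE_I2)
      fix \<xi> :: real
      let ?w = "norm (root_symbol \<mu> m \<xi>)"
      have w: "?w ^ (2 * m) = \<mu>\<^sup>2 + \<xi>\<^sup>2"
        unfolding mult.commute[of 2 m] power_mult norm_root_symbol_power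
        by (simp add: cmod_power2)
      have pos: "\<mu>\<^sup>2 + \<xi>\<^sup>2 > 0" using \<mu> by (simp add: add_pos_nonneg)
      have "exp (- c * Re (root_symbol \<mu> m \<xi>)) \<le> exp (- (c / 2) * ?w)"
        using Re_root_symbol_ge[of \<xi>] c by (simp add: field_simps)
      then have "?w ^ n * exp (- c * Re (root_symbol \<mu> m \<xi>)) \<le> ?w ^ n * exp (- (c / 2) * ?w)"
        by (intro mult_left_mono) auto
      also have "\<dots> = ?w ^ N * exp (- (c / 2) * ?w) / (\<mu>\<^sup>2 + \<xi>\<^sup>2)"
        using pos \<mu> by (simp add: N_def power_add w)
      also have "\<dots> \<le> fact N / (c / 2) ^ N / (\<mu>\<^sup>2 + \<xi>\<^sup>2)"
        using pos c by (intro divide_right_mono power_mult_exp_le) auto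
      also have "\<dots> = fact N / (c / 2) ^ N * (1 / (\<mu>\<^sup>2 + \<xi>\<^sup>2))" by simp
      also have "\<dots> \<le> fact N / (c / 2) ^ N * ((1 + 1 / \<mu>\<^sup>2) * inverse (1 + \<xi>\<^sup>2))"
      proof (rule mult_left_mono)
        have "1 + \<xi>\<^sup>2 \<le> (1 + 1 / \<mu>\<^sup>2) * (\<mu>\<^sup>2 + \<xi>\<^sup>2)"
          using \<mu> by (simp add: field_simps add_nonneg_nonneg)
        moreover have "1 + \<xi>\<^sup>2 > 0" by (simp add: add_pos_nonneg)
        ultimately show "1 / (\<mu>\<^sup>2 + \<xi>\<^sup>2) \<le> (1 + 1 / \<mu>\<^sup>2) * inverse (1 + \<xi>\<^sup>2)"
          using pos by (simp add: field_simps)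
      qed (use c in auto)
      finally have "?w ^ n * exp (- c * Re (root_symbol \<mu> m \<xi>)) \<le> A * inverse (1 + \<xi>\<^sup>2)"
        by (simp only: A_def mult.assoc)
      moreover have "norm (?w ^ n * exp (- c * Re (root_symbol \<mu> m \<xi>))) = ?w ^ n * exp (- c * Re (root_symbol \<mu> m \<xi>))"
        by simp
      ultimately show "norm (?w ^ n * exp (- c * Re (root_symbol \<mu> m \<xi>))) \<le> norm (A * inverse (1 + \<xi>\<^sup>2))"
        by (metis abs_ge_self order_trans real_norm_def)
    qed
  qed measurable
qed

section \<open>Integrals of the Fourier kernel and their derivatives\<close>

lemma measurable_tempered_kernel [measurable]: "tempered_kernel \<mu> m x t \<in> borel_measurable borel"
  unfolding tempered_kernel_def by measurable

lemma norm_kernel: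
  "norm (tempered_kernel \<mu> m x t \<xi>) = exp (t * \<mu> powr (1 / real m)) * exp (- t * Re (root_symbol \<mu> m \<xi>))"
  by (simp add: tempered_kernel_def norm_mult tempered_exponent_def algebra_simps flip: exp_add)

text \<open>The multiplier \<open>q\<close> may grow like any fixed power of the symbol, which
  covers the factors produced by repeated time derivatives.\<close>

lemma integrable_kernel:
  assumes [measurable]: "q \<in> borel_measurable borel"
    and q: "\<And>\<xi>. norm (q \<xi>) \<le> K * norm (root_symbol \<mu> m \<xi>) ^ n" and t: "0 < t"
  shows "integrable lborel (\<lambda>\<xi>. q \<xi> * tempered_kernel \<mu> m x t \<xi>)"
proof (rule Bochner_Integration.integrable_bound)
  let ?B = "\<lambda>\<xi>. K * exp (t * \<mu> powr (1 / real m)) * (norm (root_symbol \<mu> m \<xi>) ^ n * exp (- t * Re (root_symbol \<mu> m \<xi>)))"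
  show "integrable lborel ?B"
    by (intro integrable_mult_right integrable_symbol_power_exp t)
  have "norm (q \<xi> * tempered_kernel \<mu> m x t \<xi>) \<le> ?B \<xi>" for \<xi>
    using mult_right_mono[OF q[of \<xi>], of "norm (tempered_kernel \<mu> m x t \<xi>)"]
    by (simp add: norm_mult norm_kernel mult_ac)
  then show "AE \<xi> in lborel. norm (q \<xi> * tempered_kernel \<mu> m x t \<xi>) \<le> norm (?B \<xi>)"
    by (intro AE_I2) (metis abs_ge_self order_trans real_norm_def)
qed measurable

text \<open>The general multiplier makes the statement iterable:
  \<open>- tempered_exponent \<mu> m \<xi> * q \<xi>\<close> satisfies a bound of the same kind with
  one more power.\<close>

lemma kernel_integral_deriv_time:
  assumes [measurable]: "q \<in> borel_measurable borel"
    and q: "\<And>\<xi>. norm (q \<xi>) \<le> K * norm (root_symbol \<mu> m \<xi>) ^ n" and t: "0 < t"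
  shows "((\<lambda>t. CLBINT \<xi>. q \<xi> * tempered_kernel \<mu> m x t \<xi>) has_vector_derivative
    (CLBINT \<xi>. (- tempered_exponent \<mu> m \<xi> * q \<xi>) * tempered_kernel \<mu> m x t \<xi>)) (at t)"
\<comment> \<open>On this window the decay rate is at least \<open>t / 2\<close>, and the factor
  \<open>exp (r * \<mu> powr (1 / real m))\<close> is at most its value at \<open>2 * t\<close>, so
  one majorant serves all \<open>r\<close>.\<close>
proof (rule has_vector_derivative_integral[where S = "{t / 2<..<2 * t}"])
  let ?B = "\<lambda>\<xi>. 2 * K * exp (2 * t * \<mu> powr (1 / real m)) *
    (norm (root_symbol \<mu> m \<xi>) ^ Suc n * exp (- (t / 2) * Re (root_symbol \<mu> m \<xi>)))"
  show "integrable lborel ?B"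
    using t by (intro integrable_mult_right integrable_symbol_power_exp) auto
  show "norm ((- tempered_exponent \<mu> m \<xi> * q \<xi>) * tempered_kernel \<mu> m x r \<xi>) \<le> ?B \<xi>" if "r \<in> {t / 2<..<2 * t}" for r \<xi>
  proof -
    have "0 \<le> Re (root_symbol \<mu> m \<xi>)"
      using Re_root_symbol_ge[of \<xi>] norm_ge_zero[of "root_symbol \<mu> m \<xi>"] by linarith
    then have "t / 2 * Re (root_symbol \<mu> m \<xi>) \<le> r * Re (root_symbol \<mu> m \<xi>)"
      using that by (intro mult_right_mono) auto
    then have "norm (tempered_kernel \<mu> m x r \<xi>) \<le> exp (2 * t * \<mu> powr (1 / real m)) * exp (- (t / 2) * Re (root_symbol \<mu> m \<xi>))"
      unfolding norm_kernel using that by (intro mult_mono) (auto intro!: mult_right_mono)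
    moreover have "norm (- tempered_exponent \<mu> m \<xi> * q \<xi>) \<le> (2 * norm (root_symbol \<mu> m \<xi>)) * (K * norm (root_symbol \<mu> m \<xi>) ^ n)"
      unfolding norm_mult norm_minus_cancel by (intro mult_mono q norm_tempered_exponent_le) auto
    ultimately have "norm (- tempered_exponent \<mu> m \<xi> * q \<xi>) * norm (tempered_kernel \<mu> m x r \<xi>) \<le>
        ((2 * norm (root_symbol \<mu> m \<xi>)) * (K * norm (root_symbol \<mu> m \<xi>) ^ n)) *
        (exp (2 * t * \<mu> powr (1 / real m)) * exp (- (t / 2) * Re (root_symbol \<mu> m \<xi>)))"
      by (intro mult_mono') auto
    then show ?thesis by (simp add: norm_mult mult_ac)
  qed
  show "((\<lambda>t. q \<xi> * tempered_kernel \<mu> m x t \<xi>) has_vector_derivative (- tempered_exponent \<mu> m \<xi> * q \<xi>) * tempered_kernel \<mu> m x r \<xi>) (at r)" for r \<xi>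
  proof -
    \<comment> \<open>Time is made a complex variable \<open>z\<close>, so that field derivatives
      apply; the result is then restricted to the real axis.\<close>
    have "((\<lambda>z. q \<xi> * (iexp (- (\<xi> * x)) * exp (- z * tempered_exponent \<mu> m \<xi>))) has_field_derivative
        (- tempered_exponent \<mu> m \<xi> * q \<xi>) * (iexp (- (\<xi> * x)) * exp (- r * tempered_exponent \<mu> m \<xi>))) (at (complex_of_real r))"
      by (auto intro!: derivative_eq_intros simp: mult_ac)
    from has_vector_derivative_real_field[OF this, of UNIV] show ?thesis
      by (simp add: tempered_kernel_def)
  qed
  show "integrable lborel (\<lambda>\<xi>. q \<xi> * tempered_kernel \<mu> m x r \<xi>)" if "r \<in> {t / 2<..<2 * t}" for r
    using that t by (intro integrable_kernel[OF _ q]) auto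
qed (use t in auto)

text \<open>The factor \<open>\<xi>\<close> is bounded by the \<open>m\<close>-th power of the norm
  of the symbol. The position enters only through a unimodular factor, so the majorant is uniform on
  \<open>UNIV\<close>.\<close>

lemma kernel_integral_deriv_space:
  assumes t: "0 < t"
  shows "((\<lambda>x. CLBINT \<xi>. tempered_kernel \<mu> m x t \<xi>) has_vector_derivative
    (CLBINT \<xi>. (- \<i> * \<xi>) * tempered_kernel \<mu> m x t \<xi>)) (at x)"
proof (rule has_vector_derivative_integral[where S = UNIV])
  let ?B = "\<lambda>\<xi>. exp (t * \<mu> powr (1 / real m)) * (norm (root_symbol \<mu> m \<xi>) ^ m * exp (- t * Re (root_symbol \<mu> m \<xi>)))"
  show "integrable lborel ?B"
    by (intro integrable_mult_right integrable_symbol_power_exp t)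
  show "norm ((- \<i> * \<xi>) * tempered_kernel \<mu> m r t \<xi>) \<le> ?B \<xi>" for r \<xi>
  proof -
    have "\<bar>\<xi>\<bar> \<le> norm (root_symbol \<mu> m \<xi>) ^ m"
      unfolding norm_root_symbol_power using abs_Im_le_cmod[of "complex_of_real \<mu> - \<i> * \<xi>"] by simp
    from mult_right_mono[OF this, of "norm (tempered_kernel \<mu> m r t \<xi>)"] show ?thesis
      by (simp add: norm_mult norm_kernel mult_ac)
  qed
  show "((\<lambda>x. tempered_kernel \<mu> m x t \<xi>) has_vector_derivative (- \<i> * \<xi>) * tempered_kernel \<mu> m r t \<xi>) (at r)" for r \<xi>
  proof -
    have "((\<lambda>z. exp (- \<i> * \<xi> * z) * exp (- complex_of_real t * tempered_exponent \<mu> m \<xi>)) has_field_derivative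
        (- \<i> * \<xi>) * (exp (- \<i> * \<xi> * r) * exp (- complex_of_real t * tempered_exponent \<mu> m \<xi>))) (at (complex_of_real r))"
      by (auto intro!: derivative_eq_intros simp: mult_ac)
    from has_vector_derivative_real_field[OF this, of UNIV] show ?thesis
      by (simp add: tempered_kernel_def mult.assoc)
  qed
  show "integrable lborel (\<lambda>\<xi>. tempered_kernel \<mu> m r t \<xi>)" for r
    using integrable_kernel[of "\<lambda>_. 1" 1 0 t r] t by simp
qed auto

section \<open>The binomial identity\<close>

text \<open>The factor \<open>(-1) ^ j\<close> cancels the sign in
  \<open>(- tempered_exponent \<mu> m \<xi>) ^ j\<close>. What remains is the binomial expansion of
  the \<open>m\<close>-th power of the root symbol, without its term for
  \<open>j = 0\<close>.\<close>

lemma binomial_tempered_exponent: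
  "(\<Sum>j = 1..m. complex_of_real ((-1) ^ j * real (m choose j) * \<mu> powr (1 - real j / real m)) *
     (- tempered_exponent \<mu> m \<xi>) ^ j) = - \<i> * \<xi>" (is "?S = _")
proof -
  define a where "a = \<mu> powr (1 / real m)"
  have a: "a ^ (m - j) = \<mu> powr (1 - real j / real m)" if "j \<le> m" for j
    using that \<mu> m by (simp add: a_def powr_powr of_nat_diff diff_divide_distrib flip: powr_realpow)
  have "complex_of_real \<mu> - \<i> * \<xi> = (tempered_exponent \<mu> m \<xi> + complex_of_real a) ^ m"
    by (simp add: tempered_exponent_def a_def root_symbol_power)
  also have "\<dots> = (\<Sum>j\<le>m. of_nat (m choose j) * tempered_exponent \<mu> m \<xi> ^ j * complex_of_real a ^ (m - j))"
    by (rule binomial_ring)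
  also have "\<dots> = (\<Sum>j = 0..m. complex_of_real ((-1) ^ j * real (m choose j) * \<mu> powr (1 - real j / real m)) *
     (- tempered_exponent \<mu> m \<xi>) ^ j)"
    unfolding atMost_atLeast0
  proof (intro sum.cong refl)
    fix j assume "j \<in> {0..m}"
    then have "complex_of_real a ^ (m - j) = complex_of_real (\<mu> powr (1 - real j / real m))"
      using a[of j] by (metis atLeastAtMost_iff of_real_power)
    moreover have "(- tempered_exponent \<mu> m \<xi>) ^ j = (-1) ^ j * tempered_exponent \<mu> m \<xi> ^ j"
      by (rule power_minus)
    ultimately show "of_nat (m choose j) * tempered_exponent \<mu> m \<xi> ^ j * complex_of_real a ^ (m - j) =
        complex_of_real ((-1) ^ j * real (m choose j) * \<mu> powr (1 - real j / real m)) * (- tempered_exponent \<mu> m \<xi>) ^ j"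
      by (simp add: mult_ac flip: power_mult_distrib)
  qed
  \<comment> \<open>The term \<open>j = 0\<close> equals \<open>\<mu> powr 1 = \<mu>\<close>, which
    cancels the real part on the other side.\<close>
  also have "\<dots> = complex_of_real \<mu> + ?S"
    using \<mu> by (subst sum.atLeast_Suc_atMost) auto
  finally have eq: "complex_of_real \<mu> - \<i> * \<xi> = complex_of_real \<mu> + ?S" .
  have "?S = (complex_of_real \<mu> + ?S) - complex_of_real \<mu>" by (rule add_diff_cancel_left'[symmetric])
  also have "\<dots> = - \<i> * \<xi>" unfolding eq[symmetric] by simp
  finally show ?thesis .
qed

section \<open>Fourier representation of the tempered density\<close>

text \<open>The characteristic function is the Laplace transform of \<open>f\<close> continued to
  \<open>\<mu> - \<i>\<xi>\<close>, times a normalising constant. It is integrable, and continuity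
  on the half-line makes the inversion hold at every \<open>x > 0\<close>.\<close>

lemma tempered_density_eq:
  assumes f: "stable_subordinator_density (1 / real m) f" and x: "0 < x" and t: "0 < t"
  shows "complex_of_real (tempered_density \<mu> (1 / real m) f x t) = 1 / (2 * pi) * (CLBINT \<xi>. tempered_kernel \<mu> m x t \<xi>)"
proof -
  \<comment> \<open>The values of \<open>f\<close> at nonpositive points are unconstrained, hence
    the cut-off by the indicator.\<close>
  define h where "h y = indicator {0<..} y * tempered_density \<mu> (1 / real m) f y t" for y
  let ?M = "density lborel (\<lambda>y. ennreal (h y))"
  have mass: "has_bochner_integral lborel h 1"
    using tempered_density_laplace[OF f \<mu> t, of 0] by (simp add: h_def[abs_def])
  have nonneg: "0 \<le> h y" for y
    using f t by (auto simp: h_def tempered_density_def stable_subordinator_density_def indicator_def)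
  have [measurable]: "h \<in> borel_measurable borel"
    using mass by (auto simp: has_bochner_integral_iff)
  have prob: "prob_space ?M"
  proof
    have "emeasure ?M (space ?M) = (\<integral>\<^sup>+ y. ennreal (h y) \<partial>lborel)"
      by (simp add: emeasure_density)
    also have "\<dots> = 1"
      using mass nonneg by (subst nn_integral_eq_integral) (auto simp: has_bochner_integral_iff)
    finally show "emeasure ?M (space ?M) = 1" .
  qed
  have char: "char ?M \<xi> = exp (- complex_of_real t * tempered_exponent \<mu> m \<xi>)" for \<xi>
  proof -
    have "char ?M \<xi> = (CLBINT y. h y *\<^sub>R iexp (\<xi> * y))"
      unfolding char_def using nonneg by (subst integral_density) auto
    also have "\<dots> = (CLBINT y. exp (complex_of_real (t * \<mu> powr (1 / real m))) *
        (exp (- (complex_of_real \<mu> - \<i> * \<xi>) * complex_of_real y) * complex_of_real (indicator {0<..} y * f y t)))"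
      by (intro Bochner_Integration.integral_cong refl)
        (simp add: h_def tempered_density_def scaleR_conv_of_real exp_of_real[symmetric] algebra_simps exp_add exp_diff exp_minus)
    also have "\<dots> = exp (complex_of_real (t * \<mu> powr (1 / real m))) * exp (- complex_of_real t * root_symbol \<mu> m \<xi>)"
      using stable_subordinator_complex_laplace[OF f t, of "complex_of_real \<mu> - \<i> * \<xi>"] \<mu>
      by (simp add: root_symbol_def)
    also have "\<dots> = exp (- complex_of_real t * tempered_exponent \<mu> m \<xi>)"
      by (simp add: tempered_exponent_def algebra_simps flip: exp_add)
    finally show ?thesis .
  qed
  \<comment> \<open>At position 0 the kernel is the characteristic function.\<close>
  have "integrable lborel (tempered_kernel \<mu> m 0 t)"
    using integrable_kernel[of "\<lambda>_. 1" 1 0 t 0] t by simp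
  then have int: "integrable lborel (char ?M)"
    by (simp add: tempered_kernel_def[abs_def] char[abs_def])
  have cont: "continuous_on {0<..} h"
  proof -
    have "continuous_on {0<..} (\<lambda>y. tempered_density \<mu> (1 / real m) f y t)"
      using f t unfolding tempered_density_def stable_subordinator_density_def
      by (intro continuous_intros) auto
    then show ?thesis
      by (rule continuous_on_cong[THEN iffD1, rotated 2]) (auto simp: h_def)
  qed
  have "complex_of_real (h x) = 1 / (2 * pi) * (CLBINT \<xi>. iexp (- (\<xi> * x)) * char ?M \<xi>)"
    using x by (intro density_eq_integral_char[OF prob _ nonneg int _ _ cont]) auto
  also have "\<dots> = 1 / (2 * pi) * (CLBINT \<xi>. tempered_kernel \<mu> m x t \<xi>)"
    by (simp only: char tempered_kernel_def)
  also have "h x = tempered_density \<mu> (1 / real m) f x t"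
    using x by (simp add: h_def)
  finally show ?thesis .
qed

end

section \<open>The differential equation\<close>

theorem proposition4p1:
  fixes \<mu> \<beta> x t :: real and m :: nat and f f\<^sub>\<mu> :: "real \<Rightarrow> real \<Rightarrow> real"
  assumes "\<mu> > 0" and "m \<ge> 2" and "\<beta> = 1 / real m"
    and "stable_subordinator_density \<beta> f"
    and "f\<^sub>\<mu> = tempered_density \<mu> \<beta> f"
    and "x > 0" and "t > 0"
  shows "(\<forall>j<m. (deriv ^^ j) (\<lambda>\<tau>. f\<^sub>\<mu> x \<tau>) field_differentiable (at t)) \<and>
         (\<lambda>\<xi>. f\<^sub>\<mu> \<xi> t) field_differentiable (at x) \<and>
         (\<Sum>j = 1..m. (-1) ^ j * real (m choose j) * \<mu> powr (1 - real j / real m) *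
             (deriv ^^ j) (\<lambda>\<tau>. f\<^sub>\<mu> x \<tau>) t)
         = deriv (\<lambda>\<xi>. f\<^sub>\<mu> \<xi> t) x"
proof -
  note \<mu>m = assms(1,2)
  define k where "k = tempered_kernel \<mu> m"
  define q where "q j \<xi> = (- tempered_exponent \<mu> m \<xi>) ^ j" for j \<xi>
  \<comment> \<open>The candidate for the \<open>j\<close>-th time derivative: each derivative
    contributes one factor \<open>- tempered_exponent \<mu> m \<xi>\<close>.\<close>
  define J where "J j \<tau> = Re (1 / (2 * pi) * (CLBINT \<xi>. q j \<xi> * k x \<tau> \<xi>))" for j \<tau>
  have q_meas: "q j \<in> borel_measurable borel" for j
    unfolding q_def using measurable_tempered_exponent[OF \<mu>m] by measurable
  have q_le: "norm (q j \<xi>) \<le> 2 ^ j * norm (root_symbol \<mu> m \<xi>) ^ j" for j \<xi>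
    unfolding q_def norm_power norm_minus_cancel power_mult_distrib[symmetric]
    by (intro power_mono norm_tempered_exponent_le \<mu>m) auto
  have f: "f\<^sub>\<mu> y \<tau> = Re (1 / (2 * pi) * (CLBINT \<xi>. k y \<tau> \<xi>))" if "0 < y" "0 < \<tau>" for y \<tau>
    using tempered_density_eq[OF \<mu>m, of f y \<tau>] assms(3-5) that unfolding k_def by (metis Re_complex_of_real)
  have J_deriv: "(J j has_real_derivative J (Suc j) \<tau>) (at \<tau>)" if "0 < \<tau>" for j \<tau>
    unfolding J_def has_real_derivative_iff_has_vector_derivative k_def
    using kernel_integral_deriv_time[OF \<mu>m q_meas q_le that, of j x]
    by (intro bounded_linear.has_vector_derivative[OF bounded_linear_Re] has_vector_derivative_mult_right)
      (simp add: q_def)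
  have near: "eventually (\<lambda>u. u \<in> {0<..}) (nhds \<tau>)" if "0 < \<tau>" for \<tau> :: real
    using that by (intro eventually_nhds_in_open) auto
  \<comment> \<open>\<open>deriv\<close> depends on values near the point, so the induction needs
    the identity at all positive times. They form an open set, which suffices.\<close>
  have derivs: "(deriv ^^ j) (\<lambda>\<tau>. f\<^sub>\<mu> x \<tau>) \<tau> = J j \<tau>" if "0 < \<tau>" for j \<tau>
    using that
  proof (induction j arbitrary: \<tau>)
    case 0
    then show ?case using f[OF assms(6)] by (simp add: J_def q_def)
  next
    case (Suc j)
    have "deriv ((deriv ^^ j) (\<lambda>\<tau>. f\<^sub>\<mu> x \<tau>)) \<tau> = deriv (J j) \<tau>"
      using near[OF Suc.prems] by (intro deriv_cong_ev) (auto elim!: eventually_mono simp: Suc.IH)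
    also have "\<dots> = J (Suc j) \<tau>"
      using J_deriv[OF Suc.prems] by (rule DERIV_imp_deriv)
    finally show ?case by simp
  qed
  have "((deriv ^^ j) (\<lambda>\<tau>. f\<^sub>\<mu> x \<tau>) has_real_derivative J (Suc j) t) (at t)" for j
    using J_deriv[OF assms(7)]
    by (rule DERIV_cong_ev[THEN iffD2, rotated 3])
      (use near[OF assms(7)] in \<open>auto elim!: eventually_mono simp: derivs\<close>)
  then have time: "(deriv ^^ j) (\<lambda>\<tau>. f\<^sub>\<mu> x \<tau>) field_differentiable (at t)" for j
    unfolding field_differentiable_def by blast
  let ?D = "Re (1 / (2 * pi) * (CLBINT \<xi>. (- \<i> * \<xi>) * k x t \<xi>))"
  have "((\<lambda>y. Re (1 / (2 * pi) * (CLBINT \<xi>. k y t \<xi>))) has_real_derivative ?D) (at x)"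
    unfolding has_real_derivative_iff_has_vector_derivative k_def
    by (intro bounded_linear.has_vector_derivative[OF bounded_linear_Re] has_vector_derivative_mult_right
        kernel_integral_deriv_space \<mu>m assms)
  then have space: "((\<lambda>y. f\<^sub>\<mu> y t) has_real_derivative ?D) (at x)"
    by (rule DERIV_cong_ev[THEN iffD2, rotated 3])
      (use near[OF assms(6)] in \<open>auto elim!: eventually_mono simp: f assms(7)\<close>)
  define c where "c j = (-1) ^ j * real (m choose j) * \<mu> powr (1 - real j / real m)" for j
  have "(\<Sum>j = 1..m. c j * J j t) =
      Re (1 / (2 * pi) * (\<Sum>j = 1..m. complex_of_real (c j) * (CLBINT \<xi>. q j \<xi> * k x t \<xi>)))"
    unfolding J_def by (simp add: sum_distrib_left mult_ac)
  also have "(\<Sum>j = 1..m. complex_of_real (c j) * (CLBINT \<xi>. q j \<xi> * k x t \<xi>)) =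
      (CLBINT \<xi>. (\<Sum>j = 1..m. complex_of_real (c j) * (q j \<xi> * k x t \<xi>)))"
    unfolding k_def using integrable_kernel[OF \<mu>m q_meas q_le assms(7)]
    by (subst Bochner_Integration.integral_sum) auto
  \<comment> \<open>Under the integral sign the equation is the binomial identity times the
    kernel.\<close>
  also have "(\<lambda>\<xi>. \<Sum>j = 1..m. complex_of_real (c j) * (q j \<xi> * k x t \<xi>)) = (\<lambda>\<xi>. (- \<i> * \<xi>) * k x t \<xi>)"
    unfolding binomial_tempered_exponent[OF \<mu>m, symmetric] sum_distrib_right
    by (simp only: c_def q_def mult.assoc)
  finally have "(\<Sum>j = 1..m. c j * J j t) = ?D" .
  also have "?D = deriv (\<lambda>y. f\<^sub>\<mu> y t) x"
    using DERIV_imp_deriv[OF space] by (rule sym)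
  finally show ?thesis
    using time space unfolding c_def derivs[OF assms(7)] field_differentiable_def by blast
qed

end
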